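(* Let $\overline{x}\in X\cap F_b$ be such that $\phi(\overline{x})\in\mathbb{R}$. (a) The following three statements are equivalent: (i) $\overline{x}$ is a solution of problem $(P)$; (ii) $\phi'(\overline{x},x-\overline{x})\geq 0$ for all $x\in F_b\cap\operatorname{dom}\phi$; (iii) $\int_T \varphi'(\overline{x}(t))\cdot u(t)\,d\mu(t)\geq 0$ for all $u\in K_{\overline{x}}:=\left[\mathbb{R}_+(\operatorname{dom}\phi-\overline{x})\right]\cap\widetilde{X}^0$. (b) If there exist $\alpha_1,\ldots,\alpha_m\in\mathbb{R}$ such that $\varphi'\circ\overline{x}=\alpha_1\psi_1+\ldots+\alpha_m\psi_m$ (a.e. on $T$), then $\overline{x}$ is an optimal solution of problem $(P)$.
   Context: Let $(T,\mathcal{A},\mu)$ be a measure space, $\overline{\mathbb{R}}:=\mathbb{R}\cup\{-\infty,\infty\}$, $\mathcal{M}$ the set of measurable functions $x:T\to\overline{\mathbb{R}}$ (functions equal a.e. are identified), and $\mathcal{M}_0:=\{x\in\mathcal{M}\mid x(t)\in\mathbb{R}\text{ for a.e. }t\in T\}$. Conventions: $\infty-\infty:=+\infty+(-\infty):=-\infty+\infty:=\infty$ and $0\cdot(\pm\infty):=(\pm\infty)\cdot 0:=0$. For every $x\in\mathcal{M}$, $\int_T x\,d\mu:=\int_T x_+\,d\mu-\int_T x_-\,d\mu\in\overline{\mathbb{R}}$, where $x_+=\max\{x,0\}$, $x_-=(-x)_+$; thus the integral is always defined, and equals $+\infty$ whenever $\int_T x_+d\mu=\infty$. $L_1$ is the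 class of $x\in\mathcal{M}$ with $\int_T x\,d\mu\in\mathbb{R}$ (equivalently $\int_T x_+d\mu<\infty$ and $\int_T x_-d\mu<\infty$). Let $\varphi:\mathbb{R}\to\overline{\mathbb{R}}$ be a proper, convex, lower semicontinuous function which is strictly convex on $I:=\operatorname{dom}\varphi=\{u\in\mathbb{R}\mid\varphi(u)<\infty\}$, with $\operatorname{int}I\neq\emptyset$, and differentiable on $\operatorname{int}I$. Put $\varphi(\pm\infty):=\infty$. If $a_0:=\inf I\in\mathbb{R}$ and $\varphi(a_0)\in\mathbb{R}$, set $\varphi'(a_0):=\varphi'_+(a_0)=\lim_{u\to a_0+}\varphi'(u)\in[-\infty,\infty[$; if $b_0:=\sup I\in\mathbb{R}$ and $\varphi(b_0)\in\mathbb{R}$, set $\varphi'(b_0):=\varphi'_-(b_0)=\lim_{u\to b_0-}\varphi'(u)\in\,]-\infty,\infty]$. So $\varphi'$ is defined on all of $I$ with values in $\overline{\mathbb{R}}$. Let $X\subset\mathcal{M}_0$ be a linear space and define $\phi:X\to\overline{\mathbb{R}}$, $\phi(x):=\int_T\varphi\circ x\,d\mu$; $\operatorname{dom}\phi:=\{x\in X\mid\phi(x)<\infty\}$. (For $x\in\operatorname{dom}\phi$ one has $x(t)\in\operatorname{dom}\varphi$ for a.e. $t$.) For $\overline{x},x\in\operatorname{dom}\phi$ with $\phi(\overline{x})\in\mathbb{R}$, $\phi'(\overline{x},x-\overline{x}):=\lim_{s\to0+}\frac{\phi(\overline{x}+s(x-\overline{x}))-\phi(\overline{x})}{s}$. Let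 $\psi_1,\ldots,\psi_m\in\mathcal{M}_0$ and $b=(b_1,\ldots,b_m)\in\mathbb{R}^m$. For $k\in\{1,\ldots,m\}$ let $X_k:=\{x\in\mathcal{M}_0\mid x\psi_k\in L_1\}$ and $\Psi_k:X_k\to\mathbb{R}$, $\Psi_k(x):=\int_T x\psi_k\,d\mu$. Put $X_k^0:=\{x\in X_k\mid\Psi_k(x)=0\}$, $\widetilde{X}:=\bigcap_{k=1}^m X_k$, $\widetilde{X}^0:=\bigcap_{k=1}^m X_k^0$, and $F_b:=\{x\in\widetilde{X}\mid\Psi_k(x)=b_k\ \forall k\in\{1,\ldots,m\}\}$. Problem $(P)$ is: minimize $\phi(x)$ subject to $x\in X\cap\widetilde{X}$ with $\Psi_k(x)=b_k$ for all $k\in\{1,\ldots,m\}$ (i.e. $x\in X\cap F_b$). A solution (optimal solution) of $(P)$ is an element $\overline{x}\in X\cap F_b$ with $\phi(\overline{x})\leq\phi(x)$ for all $x\in X\cap F_b$. Here $\mathbb{R}_+(\operatorname{dom}\phi-\overline{x}):=\{\lambda(x-\overline{x})\mid\lambda\geq0,\ x\in\operatorname{dom}\phi\}$. *)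

theory Defs
  imports "HOL-Analysis.Analysis"
begin

text \<open>
  Addition, subtraction and multiplication on \<^typ>\<open>ereal\<close> obey exactly the conventions needed here:
  \<open>\<infinity> + (-\<infinity>) = -\<infinity> + \<infinity> = \<infinity> - \<infinity> = \<infinity>\<close> and \<open>0 * (\<plusminus>\<infinity>) = 0\<close>.

  Functions that are equal almost everywhere are identified. A set of classes is represented by the
  set of all measurable representatives of its members, i.e. by a set that is closed under
  almost-everywhere equality.
\<close>

subsection \<open>Extended real-valued functions on the real line\<close>

definition edom :: "(real \<Rightarrow> ereal) \<Rightarrow> real set" where
  "edom \<phi> = {u. \<phi> u < \<infinity>}"

definition proper_ereal :: "(real \<Rightarrow> ereal) \<Rightarrow> bool" where
  "proper_ereal \<phi> \<longleftrightarrow> edom \<phi> \<noteq> {} \<and> (\<forall>u. \<phi> u \<noteq> -\<infinity>)"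

definition convex_ereal :: "(real \<Rightarrow> ereal) \<Rightarrow> bool" where
  "convex_ereal \<phi> \<longleftrightarrow>
     (\<forall>u v. \<forall>l\<in>{0..1}. \<phi> ((1 - l) * u + l * v) \<le> ereal (1 - l) * \<phi> u + ereal l * \<phi> v)"

definition strictly_convex_ereal_on :: "real set \<Rightarrow> (real \<Rightarrow> ereal) \<Rightarrow> bool" where
  "strictly_convex_ereal_on S \<phi> \<longleftrightarrow>
     (\<forall>u\<in>S. \<forall>v\<in>S. \<forall>l\<in>{0<..<1}. u \<noteq> v \<longrightarrow>
        \<phi> ((1 - l) * u + l * v) < ereal (1 - l) * \<phi> u + ereal l * \<phi> v)"

definition lsc_ereal :: "(real \<Rightarrow> ereal) \<Rightarrow> bool" where
  "lsc_ereal \<phi> \<longleftrightarrow> (\<forall>u. \<phi> u \<le> Liminf (at u) \<phi>)"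

text \<open>
  The derivative of \<open>\<phi>\<close> on \<^term>\<open>edom \<phi>\<close>: at an endpoint belonging to the domain it is the
  one-sided derivative, which may be infinite. (For convex \<open>\<phi>\<close> the limits exist in \<^typ>\<open>ereal\<close>.)
  The value \<open>0\<close> off the domain is a dummy.
\<close>
definition ext_deriv :: "(real \<Rightarrow> ereal) \<Rightarrow> real \<Rightarrow> ereal" where
  "ext_deriv \<phi> u =
     (if u \<notin> edom \<phi> then 0
      else if u \<in> interior (edom \<phi>) then ereal (deriv (\<lambda>v. real_of_ereal (\<phi> v)) u)
      else if bdd_below (edom \<phi>) \<and> u = Inf (edom \<phi>)
        then Lim (at_right u) (\<lambda>v. (\<phi> v - \<phi> u) / ereal (v - u))
      else Lim (at_left u) (\<lambda>v. (\<phi> v - \<phi> u) / ereal (v - u)))"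

definition ext_infty :: "(real \<Rightarrow> ereal) \<Rightarrow> ereal \<Rightarrow> ereal" where
  "ext_infty \<phi> u = (if \<bar>u\<bar> = \<infinity> then \<infinity> else \<phi> (real_of_ereal u))"

subsection \<open>Measurable functions and the integral\<close>

definition M0_space :: "'a measure \<Rightarrow> ('a \<Rightarrow> ereal) set" where
  "M0_space M = {x \<in> borel_measurable M. AE t in M. \<bar>x t\<bar> \<noteq> \<infinity>}"

text \<open>Always defined, and \<open>\<infinity>\<close> whenever the positive part has infinite integral.\<close>
definition ext_integral :: "'a measure \<Rightarrow> ('a \<Rightarrow> ereal) \<Rightarrow> ereal" where
  "ext_integral M x =
     enn2ereal (\<integral>\<^sup>+ t. e2ennreal (max (x t) 0) \<partial>M)
     - enn2ereal (\<integral>\<^sup>+ t. e2ennreal (max (- x t) 0) \<partial>M)"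

definition L1_space :: "'a measure \<Rightarrow> ('a \<Rightarrow> ereal) set" where
  "L1_space M = {x \<in> borel_measurable M. \<bar>ext_integral M x\<bar> \<noteq> \<infinity>}"

definition linear_space_ae :: "'a measure \<Rightarrow> ('a \<Rightarrow> ereal) set \<Rightarrow> bool" where
  "linear_space_ae M X \<longleftrightarrow>
     X \<subseteq> M0_space M \<and>
     (\<forall>x\<in>X. \<forall>y\<in>borel_measurable M. (AE t in M. x t = y t) \<longrightarrow> y \<in> X) \<and>
     (\<lambda>t. 0) \<in> X \<and>
     (\<forall>x\<in>X. \<forall>y\<in>X. (\<lambda>t. x t + y t) \<in> X) \<and>
     (\<forall>x\<in>X. \<forall>c::real. (\<lambda>t. ereal c * x t) \<in> X)"

subsection \<open>The integral functional\<close>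

definition int_functional :: "'a measure \<Rightarrow> (real \<Rightarrow> ereal) \<Rightarrow> ('a \<Rightarrow> ereal) \<Rightarrow> ereal" where
  "int_functional M \<phi> x = ext_integral M (\<lambda>t. ext_infty \<phi> (x t))"

definition dom_functional ::
    "'a measure \<Rightarrow> (real \<Rightarrow> ereal) \<Rightarrow> ('a \<Rightarrow> ereal) set \<Rightarrow> ('a \<Rightarrow> ereal) set" where
  "dom_functional M \<phi> X = {x \<in> X. int_functional M \<phi> x < \<infinity>}"

text \<open>
  The directional derivative of the functional at \<open>x\<close> in direction \<open>h\<close>. For \<open>h = y - x\<close> with
  \<open>x\<close> of finite value and \<open>y\<close> in the domain, the limit exists in \<^typ>\<open>ereal\<close> by convexity.
\<close>
definition dir_deriv ::
    "'a measure \<Rightarrow> (real \<Rightarrow> ereal) \<Rightarrow> ('a \<Rightarrow> ereal) \<Rightarrow> ('a \<Rightarrow> ereal) \<Rightarrow> ereal" where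
  "dir_deriv M \<phi> x h =
     Lim (at_right (0::real))
       (\<lambda>s. (int_functional M \<phi> (\<lambda>t. x t + ereal s * h t) - int_functional M \<phi> x) / ereal s)"

subsection \<open>The moment constraints\<close>

definition X_sp :: "'a measure \<Rightarrow> (nat \<Rightarrow> 'a \<Rightarrow> ereal) \<Rightarrow> nat \<Rightarrow> ('a \<Rightarrow> ereal) set" where
  "X_sp M \<psi> k = {x \<in> M0_space M. (\<lambda>t. x t * \<psi> k t) \<in> L1_space M}"

definition Psi :: "'a measure \<Rightarrow> (nat \<Rightarrow> 'a \<Rightarrow> ereal) \<Rightarrow> nat \<Rightarrow> ('a \<Rightarrow> ereal) \<Rightarrow> real" where
  "Psi M \<psi> k x = real_of_ereal (ext_integral M (\<lambda>t. x t * \<psi> k t))"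

definition X0_sp :: "'a measure \<Rightarrow> (nat \<Rightarrow> 'a \<Rightarrow> ereal) \<Rightarrow> nat \<Rightarrow> ('a \<Rightarrow> ereal) set" where
  "X0_sp M \<psi> k = {x \<in> X_sp M \<psi> k. Psi M \<psi> k x = 0}"

definition X_tilde :: "'a measure \<Rightarrow> (nat \<Rightarrow> 'a \<Rightarrow> ereal) \<Rightarrow> nat \<Rightarrow> ('a \<Rightarrow> ereal) set" where
  "X_tilde M \<psi> m = (\<Inter>k\<in>{1..m}. X_sp M \<psi> k)"

definition X0_tilde :: "'a measure \<Rightarrow> (nat \<Rightarrow> 'a \<Rightarrow> ereal) \<Rightarrow> nat \<Rightarrow> ('a \<Rightarrow> ereal) set" where
  "X0_tilde M \<psi> m = (\<Inter>k\<in>{1..m}. X0_sp M \<psi> k)"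

definition F_set ::
    "'a measure \<Rightarrow> (nat \<Rightarrow> 'a \<Rightarrow> ereal) \<Rightarrow> nat \<Rightarrow> (nat \<Rightarrow> real) \<Rightarrow> ('a \<Rightarrow> ereal) set" where
  "F_set M \<psi> m b = {x \<in> X_tilde M \<psi> m. \<forall>k\<in>{1..m}. Psi M \<psi> k x = b k}"

definition is_solution ::
    "'a measure \<Rightarrow> (real \<Rightarrow> ereal) \<Rightarrow> ('a \<Rightarrow> ereal) set \<Rightarrow> (nat \<Rightarrow> 'a \<Rightarrow> ereal) \<Rightarrow> nat \<Rightarrow>
     (nat \<Rightarrow> real) \<Rightarrow> ('a \<Rightarrow> ereal) \<Rightarrow> bool" where
  "is_solution M \<phi> X \<psi> m b xb \<longleftrightarrow>
     xb \<in> X \<inter> F_set M \<psi> m b \<and>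
     (\<forall>x \<in> X \<inter> F_set M \<psi> m b. int_functional M \<phi> xb \<le> int_functional M \<phi> x)"

text \<open>
  The cone generated by \<open>D - xb\<close>. Membership is up to almost-everywhere equality, so that the set
  consists of all measurable representatives of the classes in the cone.
\<close>
definition cone_at ::
    "'a measure \<Rightarrow> ('a \<Rightarrow> ereal) set \<Rightarrow> ('a \<Rightarrow> ereal) \<Rightarrow> ('a \<Rightarrow> ereal) set" where
  "cone_at M D xb =
     {u \<in> borel_measurable M.
        \<exists>l::real. l \<ge> 0 \<and> (\<exists>x\<in>D. AE t in M. u t = ereal l * (x t - xb t))}"

definition K_cone ::
    "'a measure \<Rightarrow> (real \<Rightarrow> ereal) \<Rightarrow> ('a \<Rightarrow> ereal) set \<Rightarrow> (nat \<Rightarrow> 'a \<Rightarrow> ereal) \<Rightarrow> nat \<Rightarrow>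
     ('a \<Rightarrow> ereal) \<Rightarrow> ('a \<Rightarrow> ereal) set" where
  "K_cone M \<phi> X \<psi> m xb = cone_at M (dom_functional M \<phi> X) xb \<inter> X0_tilde M \<psi> m"

end

theory Submission
  imports Defs
begin

text \<open>
  Everything rests on one formula: if \<open>\<phi>\<close> has a finite integral along \<open>xb\<close> and an integral
  below \<open>\<infinity>\<close> along \<open>x\<close>, then the directional derivative of the integral functional at \<open>xb\<close>
  towards \<open>x\<close> is the integral of \<open>\<phi>'(xb(t)) \<cdot> (x(t) - xb(t))\<close>, and it is at most the increment of the
  functional from \<open>xb\<close> to \<open>x\<close> (\<open>directional_derivative_integral\<close>).

  Pointwise, the difference quotients of the convex function \<open>\<phi>\<close> along the segment from \<open>xb(t)\<close>
  to \<open>x(t)\<close> decrease as the step \<open>s\<close> decreases to \<open>0\<close>, and their limit is the (possibly infinite)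
  derivative times the increment, also at an endpoint of the domain, since the segment then leaves
  the endpoint into the domain (\<open>diff_quot_mono\<close>, \<open>diff_quot_tendsto_ext_deriv\<close>). The quotient
  with \<open>s = 1\<close> is \<open>\<phi>(x(t)) - \<phi>(xb(t))\<close>, whose positive part is integrable, so monotone convergence
  from above carries the limit through the integral even when the limit has integral \<open>-\<infinity>\<close>
  (\<open>ext_integral_decreasing_limit\<close>).

  The rest is convex optimization. Segments between feasible points are feasible, so a minimizer has
  nonnegative directional derivatives; conversely the increment dominates the directional
  derivative, so nonnegativity of the latter gives minimality. The feasible directions are,
  up to positive multiples and almost everywhere equality, exactly the cone in the third condition,
  and the integral of the formula is positively homogeneous in the direction. Finally, if the derivative along \<open>xb\<close>
  is a combination of the \<open>\<psi> k\<close>, its integral against a direction annihilated by all moment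
  functionals vanishes (\<open>ext_integral_combination_eq_0\<close>), so the third condition holds.
\<close>

section \<open>Difference quotients of convex functions on the line\<close>

lemma convex_erealD:
  assumes "convex_ereal \<phi>" "0 \<le> l" "l \<le> 1"
  shows "\<phi> ((1 - l) * u + l * v) \<le> ereal (1 - l) * \<phi> u + ereal l * \<phi> v"
  using assms by (auto simp: convex_ereal_def)

lemma finite_on_edom:
  assumes "proper_ereal \<phi>" "u \<in> edom \<phi>"
  shows "\<phi> u = ereal (real_of_ereal (\<phi> u))"
  using assms by (cases "\<phi> u") (auto simp: proper_ereal_def edom_def)

lemma convex_edom:
  assumes "convex_ereal \<phi>"
  shows "convex (edom \<phi>)"
proof (rule convexI)
  fix u v :: real and a b :: real
  assume "u \<in> edom \<phi>" "v \<in> edom \<phi>" "0 \<le> a" "0 \<le> b" "a + b = 1"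
  moreover from this have "a = 1 - b" "b \<le> 1" by auto
  ultimately show "a *\<^sub>R u + b *\<^sub>R v \<in> edom \<phi>"
    using convex_erealD[OF assms, of b u v]
    by (cases "\<phi> u"; cases "\<phi> v") (auto simp: edom_def split: if_splits)
qed

lemma is_interval_sublevel:
  assumes "convex_ereal \<phi>"
  shows "is_interval {u. \<phi> u \<le> ereal c}"
  unfolding is_interval_convex_1
proof (rule convexI)
  fix u v :: real and a b :: real
  assume *: "u \<in> {u. \<phi> u \<le> ereal c}" "v \<in> {u. \<phi> u \<le> ereal c}" "0 \<le> a" "0 \<le> b" "a + b = 1"
  then have ab: "a = 1 - b" "b \<le> 1" by auto
  have "\<phi> (a * u + b * v) \<le> ereal a * \<phi> u + ereal b * \<phi> v"
    using convex_erealD[OF assms, of b u v] * ab by simp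
  also have "\<dots> \<le> ereal a * ereal c + ereal b * ereal c"
    using * by (intro add_mono ereal_mult_left_mono) auto
  also have "\<dots> = ereal c" using \<open>a + b = 1\<close> by (simp flip: distrib_right)
  finally show "a *\<^sub>R u + b *\<^sub>R v \<in> {u. \<phi> u \<le> ereal c}" by simp
qed

text \<open>
  Convexity alone gives Borel measurability: the sublevel sets are intervals. Properness disposes
  of the level \<open>-\<infinity>\<close>.
\<close>
lemma convex_ereal_borel_measurable:
  assumes "proper_ereal \<phi>" "convex_ereal \<phi>"
  shows "\<phi> \<in> borel_measurable borel"
proof -
  have "{u. \<phi> u \<le> c} \<in> sets borel" for c
  proof (cases c)
    case (real r)
    then show ?thesis
      using real_interval_borel_measurable[OF is_interval_sublevel[OF assms(2)]] by simp
  qed (use assms(1) in \<open>auto simp: proper_ereal_def\<close>)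
  then show ?thesis
    by (auto simp: borel_measurable_iff_Iic_ereal vimage_def)
qed

text \<open>
  The quotient along the segment from \<open>u\<close> to \<open>u + h\<close>, without division by \<open>h\<close>: in this form it
  is nondecreasing in \<open>s\<close> for either sign of \<open>h\<close> when \<open>\<phi>\<close> is convex, and the case \<open>h = 0\<close> is
  included.
\<close>
definition diff_quot :: "(real \<Rightarrow> ereal) \<Rightarrow> real \<Rightarrow> real \<Rightarrow> real \<Rightarrow> ereal" where
  "diff_quot \<phi> u h s = (\<phi> (u + s * h) - \<phi> u) / ereal s"

lemma segment_in_edom:
  assumes "convex_ereal \<phi>" "u \<in> edom \<phi>" "u + h \<in> edom \<phi>" "0 \<le> s" "s \<le> 1"
  shows "u + s * h \<in> edom \<phi>"
proof -
  have "(1 - s) *\<^sub>R u + s *\<^sub>R (u + h) \<in> edom \<phi>"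
    using assms by (intro convexD[OF convex_edom]) auto
  then show ?thesis by (simp add: algebra_simps)
qed

text \<open>
  The point at parameter \<open>s\<close> is a convex combination, with weight \<open>s / r\<close>, of the point at
  parameter \<open>r\<close> and the base point.
\<close>
lemma diff_quot_mono:
  assumes \<phi>: "proper_ereal \<phi>" "convex_ereal \<phi>" and u: "u \<in> edom \<phi>" "u + h \<in> edom \<phi>"
    and s: "0 < s" "s \<le> r" "r \<le> 1"
  shows "diff_quot \<phi> u h s \<le> diff_quot \<phi> u h r"
proof -
  define f where "f = (\<lambda>u. real_of_ereal (\<phi> u))"
  have \<phi>f: "\<phi> v = ereal (f v)" if "v \<in> edom \<phi>" for v
    unfolding f_def using finite_on_edom[OF \<phi>(1) that] .
  have dom: "u + s * h \<in> edom \<phi>" "u + r * h \<in> edom \<phi>"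
    using segment_in_edom[OF \<phi>(2) u] s by auto
  have "\<phi> ((1 - s / r) * u + s / r * (u + r * h))
      \<le> ereal (1 - s / r) * \<phi> u + ereal (s / r) * \<phi> (u + r * h)"
    using s by (intro convex_erealD[OF \<phi>(2)]) auto
  moreover have "(1 - s / r) * u + s / r * (u + r * h) = u + s * h"
    using s by (simp add: field_simps)
  ultimately have "f (u + s * h) \<le> (1 - s / r) * f u + s / r * f (u + r * h)"
    using \<phi>f[OF dom(1)] \<phi>f[OF dom(2)] \<phi>f[OF u(1)] by simp
  then have "f (u + s * h) - f u \<le> s / r * (f (u + r * h) - f u)"
    by (simp add: algebra_simps)
  then have "(f (u + s * h) - f u) / s \<le> (f (u + r * h) - f u) / r"
    using s by (simp add: field_simps)
  then show ?thesis
    using s \<phi>f[OF dom(1)] \<phi>f[OF dom(2)] \<phi>f[OF u(1)] by (simp add: diff_quot_def)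
qed

lemma mono_tendsto_INF_at_right:
  fixes F :: "real \<Rightarrow> ereal"
  assumes mono: "\<And>s r. 0 < s \<Longrightarrow> s \<le> r \<Longrightarrow> r \<le> 1 \<Longrightarrow> F s \<le> F r"
  shows "(F \<longlongrightarrow> (INF s\<in>{0<..1}. F s)) (at_right 0)"
proof (rule decreasing_tendsto)
  show "\<forall>\<^sub>F s in at_right 0. (INF s\<in>{0<..1}. F s) \<le> F s"
    using eventually_at_right_less[of 0] eventually_at_right_real[of 0 1]
    by (auto elim!: eventually_mono intro: INF_lower)
next
  fix x assume "(INF s\<in>{0<..1}. F s) < x"
  then obtain r where r: "0 < r" "r \<le> 1" "F r < x" by (auto simp: INF_less_iff)
  show "\<forall>\<^sub>F s in at_right 0. F s < x"
    using eventually_at_right_real[OF r(1)]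
    by eventually_elim (use le_less_trans[OF mono r(3)] r(2) in auto)
qed

lemma eventually_in_at_right_1: "\<forall>\<^sub>F s::real in at_right 0. 0 < s \<and> s \<le> 1"
  using eventually_at_right_real[of 0 1] by (auto elim!: eventually_mono)

text \<open>
  Moving along the segment with parameter tending to \<open>0\<close> from above is the same as approaching the
  base point from the side that \<open>h\<close> points to. This turns the one-sided limits in the
  definition of \<^const>\<open>ext_deriv\<close> into limits of \<^const>\<open>diff_quot\<close>.
\<close>
lemma filtermap_affine_at_right:
  fixes u h :: real
  shows "h > 0 \<Longrightarrow> filtermap (\<lambda>s. u + s * h) (at_right 0) = at_right u"
    and "h < 0 \<Longrightarrow> filtermap (\<lambda>s. u + s * h) (at_right 0) = at_left u"
proof -
  have R: "filtermap (\<lambda>s. v + s * k) (at_right 0) = at_right v" if "k > 0" for v k :: real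
  proof -
    have "filtermap (\<lambda>s. v + s * k) (at_right 0) = filtermap (\<lambda>x. x + v) (filtermap (times k) (at_right 0))"
      by (simp only: filtermap_filtermap mult.commute[of k] add.commute[of v])
    also have "\<dots> = at_right v"
      using that by (simp add: filtermap_times_pos_at_right flip: at_right_to_0)
    finally show ?thesis .
  qed
  show "h > 0 \<Longrightarrow> filtermap (\<lambda>s. u + s * h) (at_right 0) = at_right u" by (rule R)
  assume "h < 0"
  have "at_left u = filtermap uminus (filtermap (\<lambda>s. - u + s * (- h)) (at_right 0))"
    using R[of "- h" "- u"] \<open>h < 0\<close> by (simp add: at_left_minus[of u])
  also have "\<dots> = filtermap (\<lambda>s. u + s * h) (at_right 0)"
    by (simp add: filtermap_filtermap add.commute[of u])
  finally show "filtermap (\<lambda>s. u + s * h) (at_right 0) = at_left u" ..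
qed

text \<open>
  Because \<^const>\<open>Lim\<close> is a definite description, its value is meaningful only once the limit is known
  to exist; monotonicity of the difference quotients supplies existence in \<^typ>\<open>ereal\<close>.
\<close>
lemma slope_limit:
  assumes \<phi>: "proper_ereal \<phi>" "convex_ereal \<phi>" and u: "u \<in> edom \<phi>" "u + h \<in> edom \<phi>"
    and h: "h \<noteq> 0" and F: "filtermap (\<lambda>s. u + s * h) (at_right 0) = F"
  shows "(diff_quot \<phi> u h \<longlongrightarrow> Lim F (\<lambda>v. (\<phi> v - \<phi> u) / ereal (v - u)) * ereal h) (at_right 0)"
proof -
  define L where "L = (INF s\<in>{0<..1}. diff_quot \<phi> u h s)"
  have lim: "(diff_quot \<phi> u h \<longlongrightarrow> L) (at_right 0)"
    unfolding L_def using diff_quot_mono[OF \<phi> u] by (intro mono_tendsto_INF_at_right) auto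
  then have "((\<lambda>s. ereal (1 / h) * diff_quot \<phi> u h s) \<longlongrightarrow> ereal (1 / h) * L) (at_right 0)"
    by (intro tendsto_cmult_ereal) auto
  moreover have "ereal (1 / h) * diff_quot \<phi> u h s = (\<phi> (u + s * h) - \<phi> u) / ereal (u + s * h - u)"
    if "0 < s" for s
  proof -
    have "ereal (1 / h) * (c * ereal (inverse s)) = c * ereal (inverse (s * h))" for c
      using that h by (cases c) (auto simp: field_simps sgn_mult zero_less_mult_iff)
    then show ?thesis using that h by (simp add: diff_quot_def divide_ereal_def)
  qed
  then have "\<forall>\<^sub>F s in at_right 0. ereal (1 / h) * diff_quot \<phi> u h s
      = (\<phi> (u + s * h) - \<phi> u) / ereal (u + s * h - u)"
    using eventually_at_right_less by (rule eventually_mono[rotated])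
  ultimately have "((\<lambda>s. (\<phi> (u + s * h) - \<phi> u) / ereal (u + s * h - u)) \<longlongrightarrow> ereal (1 / h) * L) (at_right 0)"
    by (rule Lim_transform_eventually)
  then have "((\<lambda>v. (\<phi> v - \<phi> u) / ereal (v - u)) \<longlongrightarrow> ereal (1 / h) * L) F"
    unfolding F[symmetric] filterlim_filtermap .
  moreover have "F \<noteq> bot" using F by (auto simp: filtermap_bot_iff)
  ultimately have "Lim F (\<lambda>v. (\<phi> v - \<phi> u) / ereal (v - u)) = ereal (1 / h) * L"
    by (intro tendsto_Lim)
  moreover have "ereal (1 / h) * L * ereal h = L"
    using h by (cases L) (auto simp: mult.commute)
  ultimately show ?thesis using lim by simp
qed

text \<open>
  At a point \<open>u\<close> of the domain outside its interior only one sign of \<open>h\<close> is possible: if \<open>u\<close> has a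
  point of the domain on both sides it is interior. So \<open>h > 0\<close> forces \<open>u\<close> to be the left endpoint and
  \<open>h < 0\<close> forces it to be the right one, and the one-sided derivative chosen by \<^const>\<open>ext_deriv\<close>
  is the one from the side of \<open>h\<close>.
\<close>
lemma diff_quot_tendsto_ext_deriv:
  assumes \<phi>: "proper_ereal \<phi>" "convex_ereal \<phi>"
    and diff: "(\<lambda>u. real_of_ereal (\<phi> u)) differentiable_on interior (edom \<phi>)"
    and u: "u \<in> edom \<phi>" "u + h \<in> edom \<phi>"
  shows "(diff_quot \<phi> u h \<longlongrightarrow> ext_deriv \<phi> u * ereal h) (at_right 0)"
proof (cases "h = 0")
  case True
  then have "diff_quot \<phi> u h s = 0" for s
    using finite_on_edom[OF \<phi>(1) u(1)]
    unfolding diff_quot_def by (cases "\<phi> u") auto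
  then have "diff_quot \<phi> u h = (\<lambda>s. 0)" by blast
  then show ?thesis using True by (simp flip: zero_ereal_def)
next
  case h: False
  consider "u \<in> interior (edom \<phi>)"
    | "u \<notin> interior (edom \<phi>)" "h > 0" | "u \<notin> interior (edom \<phi>)" "h < 0"
    using h by linarith
  then show ?thesis
  proof cases
    case 1
    define f where "f = (\<lambda>u. real_of_ereal (\<phi> u))"
    have "f differentiable (at u)"
      using diff 1 unfolding f_def by (metis at_within_interior differentiable_on_def interior_interior)
    then have "(f has_real_derivative deriv f u) (at u)"
      using DERIV_deriv_iff_real_differentiable by blast
    then have "((\<lambda>v. (f v - f u) / (v - u)) \<longlongrightarrow> deriv f u) (at u)"
      by (simp add: has_field_derivative_iff)
    moreover have "filterlim (\<lambda>s. u + s * h) (at u) (at_right 0)"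
      using h by (auto simp: filterlim_at intro!: tendsto_eq_intros eventually_mono[OF eventually_at_right_less])
    ultimately have "((\<lambda>s. (f (u + s * h) - f u) / (u + s * h - u) * h) \<longlongrightarrow> deriv f u * h) (at_right 0)"
      by (intro tendsto_mult tendsto_const) (rule filterlim_compose)
    then have "((\<lambda>s. ereal ((f (u + s * h) - f u) / (u + s * h - u) * h)) \<longlongrightarrow> ereal (deriv f u * h)) (at_right 0)"
      by simp
    moreover have "\<forall>\<^sub>F s in at_right 0. ereal ((f (u + s * h) - f u) / (u + s * h - u) * h) = diff_quot \<phi> u h s"
      using eventually_in_at_right_1
    proof eventually_elim
      case (elim s)
      then have "u + s * h \<in> edom \<phi>" using segment_in_edom[OF \<phi>(2) u, of s] by simp
      then have "\<phi> (u + s * h) = ereal (f (u + s * h))" "\<phi> u = ereal (f u)"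
        unfolding f_def using u(1) finite_on_edom[OF \<phi>(1)] by blast+
      then show ?case using elim h by (simp add: diff_quot_def)
    qed
    ultimately have "(diff_quot \<phi> u h \<longlongrightarrow> ereal (deriv f u * h)) (at_right 0)"
      by (rule Lim_transform_eventually)
    then show ?thesis using u 1 by (simp add: ext_deriv_def f_def)
  next
    case 2
    have "u = Inf (edom \<phi>) \<and> bdd_below (edom \<phi>)"
    proof -
      have "u \<le> v" if "v \<in> edom \<phi>" for v
      proof (rule ccontr)
        assume "\<not> u \<le> v"
        have "{v..u + h} \<subseteq> edom \<phi>"
          using convex_edom[OF \<phi>(2)] that u(2)
          by (meson is_interval_convex_1 atLeastAtMost_iff is_interval_1 subsetI)
        then have "{v<..<u + h} \<subseteq> interior (edom \<phi>)"
          by (intro interior_maximal) (auto simp: subset_iff)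
        moreover have "u \<in> {v<..<u + h}" using 2 \<open>\<not> u \<le> v\<close> by simp
        ultimately show False using 2 by blast
      qed
      then show ?thesis using u(1) by (metis bdd_below.I cInf_eq_minimum)
    qed
    then have "ext_deriv \<phi> u = Lim (at_right u) (\<lambda>v. (\<phi> v - \<phi> u) / ereal (v - u))"
      using u 2 by (simp add: ext_deriv_def)
    then show ?thesis
      using slope_limit[OF \<phi> u h filtermap_affine_at_right(1)] 2 by simp
  next
    case 3
    have "\<not> (bdd_below (edom \<phi>) \<and> u = Inf (edom \<phi>))"
      using u(2) 3 by (auto dest: cInf_lower)
    then have "ext_deriv \<phi> u = Lim (at_left u) (\<lambda>v. (\<phi> v - \<phi> u) / ereal (v - u))"
      using u 3 by (auto simp: ext_deriv_def)
    then show ?thesis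
      using slope_limit[OF \<phi> u h filtermap_affine_at_right(2)] 3 by simp
  qed
qed

text \<open>
  The gradient inequality, obtained by comparing the limit with the quotient at \<open>s = 1\<close>.
\<close>
lemma diff_quot_ge_ext_deriv:
  assumes \<phi>: "proper_ereal \<phi>" "convex_ereal \<phi>"
    and diff: "(\<lambda>u. real_of_ereal (\<phi> u)) differentiable_on interior (edom \<phi>)"
    and u: "u \<in> edom \<phi>" "u + h \<in> edom \<phi>"
  shows "ext_deriv \<phi> u * ereal h \<le> \<phi> (u + h) - \<phi> u"
proof -
  have "ext_deriv \<phi> u * ereal h \<le> diff_quot \<phi> u h 1"
    using diff_quot_tendsto_ext_deriv[OF assms] eventually_in_at_right_1 
    by (intro tendsto_upperbound[where F="at_right 0" and f="diff_quot \<phi> u h"])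
       (auto elim!: eventually_mono intro: diff_quot_mono[OF \<phi> u])
  then show ?thesis by (simp add: diff_quot_def divide_ereal_def one_ereal_def[symmetric])
qed

section \<open>The extended integral\<close>

text \<open>
  The conversion \<^const>\<open>e2ennreal\<close> already truncates at \<open>0\<close>, so the explicit positive parts can be
  dropped.
\<close>
lemma ext_integral_eq_nn_integral_diff:
  "ext_integral M f = enn2ereal (\<integral>\<^sup>+ t. e2ennreal (f t) \<partial>M) - enn2ereal (\<integral>\<^sup>+ t. e2ennreal (- f t) \<partial>M)"
proof -
  have "e2ennreal (max z 0) = e2ennreal z" for z
    by (simp add: max_def e2ennreal_neg)
  then show ?thesis by (simp add: ext_integral_def)
qed

lemma ext_integral_mono_AE:
  assumes "AE t in M. f t \<le> g t"
  shows "ext_integral M f \<le> ext_integral M g"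
  unfolding ext_integral_eq_nn_integral_diff
  using assms by (intro ereal_minus_mono) (auto simp: less_eq_ennreal.rep_eq[symmetric]
      intro!: nn_integral_mono_AE e2ennreal_mono elim!: eventually_mono)

lemma ext_integral_cong_AE:
  assumes "AE t in M. f t = g t"
  shows "ext_integral M f = ext_integral M g"
  using assms by (intro antisym ext_integral_mono_AE) (auto elim!: eventually_mono)

lemma ext_integral_cmult:
  assumes [measurable]: "f \<in> borel_measurable M" and "c > 0"
  shows "ext_integral M (\<lambda>t. ereal c * f t) = ereal c * ext_integral M f"
proof -
  have pull: "e2ennreal (ereal c * z) = ennreal c * e2ennreal z" for z
    using \<open>c > 0\<close> by (cases z) (auto simp: ennreal_mult' ennreal_mult_top e2ennreal_neg)
  have "enn2ereal (ennreal c * A) = ereal c * enn2ereal A" for A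
    using \<open>c > 0\<close> by (simp add: times_ennreal.rep_eq)
  moreover have "ereal c * (a - d) = ereal c * a - ereal c * d" for a d
    using \<open>c > 0\<close> by (cases a; cases d) (auto simp: algebra_simps)
  moreover have "- (ereal c * z) = ereal c * - z" for z by simp
  ultimately show ?thesis
    unfolding ext_integral_eq_nn_integral_diff by (simp only: pull nn_integral_cmult) (simp add: nn_integral_cmult)
qed

lemma e2ennreal_add_le: "e2ennreal (a + ereal b) \<le> e2ennreal a + ennreal b"
proof (cases a)
  case (real r)
  have "ennreal (r + b) \<le> ennreal r + ennreal b"
    by (cases "r \<ge> 0"; cases "b \<ge> 0")
       (auto simp: ennreal_neg intro!: ennreal_leI simp flip: ennreal_plus)
  then show ?thesis using real by simp
qed (auto simp: e2ennreal_neg)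

text \<open>
  The identity between the positive and negative parts of \<open>a\<close>, \<open>b\<close> and \<open>a + b\<close>, arranged without
  subtraction so that it holds for infinite \<open>a\<close> and can be integrated in \<^typ>\<open>ennreal\<close>.
\<close>
lemma e2ennreal_add_balance:
  "e2ennreal (a + ereal b) + e2ennreal (- a) + ennreal (- b)
    = e2ennreal (- (a + ereal b)) + e2ennreal a + ennreal b"
proof (cases a)
  case (real r)
  have "ennreal (r + b) + ennreal (- r) + ennreal (- b) = ennreal (- (r + b)) + ennreal r + ennreal b"
    by (cases "r \<ge> 0"; cases "b \<ge> 0"; cases "r + b \<ge> 0")
       (auto simp: ennreal_neg simp flip: ennreal_plus)
  then show ?thesis using real by (simp flip: ennreal_def)
qed (auto simp: e2ennreal_neg)

lemma ext_integral_AE_eq_integrable: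
  assumes "AE t in M. f t = ereal (g t)" "integrable M g"
  shows "ext_integral M f = ereal (integral\<^sup>L M g)"
proof -
  obtain r q where "0 \<le> r" "0 \<le> q" "(\<integral>\<^sup>+x. ennreal (g x) \<partial>M) = ennreal r"
    "(\<integral>\<^sup>+x. ennreal (- g x) \<partial>M) = ennreal q" "integral\<^sup>L M g = r - q"
    using assms(2) by (rule integrableE)
  then show ?thesis
    by (subst ext_integral_cong_AE[OF assms(1)])
       (simp add: ext_integral_eq_nn_integral_diff)
qed

lemma integrable_if_ext_integral_finite:
  assumes f[measurable]: "f \<in> borel_measurable M" and fin: "\<bar>ext_integral M f\<bar> \<noteq> \<infinity>"
  shows "AE t in M. f t = ereal (real_of_ereal (f t))"
    and "integrable M (\<lambda>t. real_of_ereal (f t))"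
proof -
  have P: "(\<integral>\<^sup>+ t. e2ennreal (f t) \<partial>M) \<noteq> \<infinity>" and N: "(\<integral>\<^sup>+ t. e2ennreal (- f t) \<partial>M) \<noteq> \<infinity>"
    using fin unfolding ext_integral_eq_nn_integral_diff
    by (cases "\<integral>\<^sup>+ t. e2ennreal (f t) \<partial>M"; cases "\<integral>\<^sup>+ t. e2ennreal (- f t) \<partial>M"; simp)+
  have "AE t in M. e2ennreal (f t) \<noteq> \<infinity>" "AE t in M. e2ennreal (- f t) \<noteq> \<infinity>"
    using P N by (intro nn_integral_PInf_AE; simp)+
  then show eq: "AE t in M. f t = ereal (real_of_ereal (f t))"
  proof eventually_elim
    case (elim t)
    then show ?case by (cases "f t") auto
  qed
  have "(\<integral>\<^sup>+ t. e2ennreal (f t) \<partial>M) = (\<integral>\<^sup>+ t. ennreal (real_of_ereal (f t)) \<partial>M)"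
    "(\<integral>\<^sup>+ t. e2ennreal (- f t) \<partial>M) = (\<integral>\<^sup>+ t. ennreal (- real_of_ereal (f t)) \<partial>M)"
    using eq by (intro nn_integral_cong_AE, eventually_elim, metis e2ennreal_ereal uminus_ereal.simps(1))+
  then show "integrable M (\<lambda>t. real_of_ereal (f t))"
    using P N by (simp add: real_integrable_def)
qed

text \<open>
  An integrable summand has finite positive and negative parts, so it cannot create a new
  \<open>\<infinity> - \<infinity>\<close>: the positive (negative) part of the sum is infinite exactly when that of \<open>f\<close> is.
  So additivity extends to \<open>f\<close> with infinite integral.
\<close>
lemma ext_integral_add_integrable:
  assumes f[measurable]: "f \<in> borel_measurable M" and g: "integrable M g"
  shows "ext_integral M (\<lambda>t. f t + ereal (g t)) = ext_integral M f + ereal (integral\<^sup>L M g)"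
proof -
  note [measurable] = borel_measurable_integrable[OF g]
  define P where "P = (\<integral>\<^sup>+ t. e2ennreal (f t + ereal (g t)) \<partial>M)"
  define N where "N = (\<integral>\<^sup>+ t. e2ennreal (- (f t + ereal (g t))) \<partial>M)"
  define A where "A = (\<integral>\<^sup>+ t. e2ennreal (f t) \<partial>M)"
  define B where "B = (\<integral>\<^sup>+ t. e2ennreal (- f t) \<partial>M)"
  obtain r q where rq: "0 \<le> r" "0 \<le> q" "(\<integral>\<^sup>+x. ennreal (g x) \<partial>M) = ennreal r"
    "(\<integral>\<^sup>+x. ennreal (- g x) \<partial>M) = ennreal q" "integral\<^sup>L M g = r - q"
    using g by (rule integrableE)
  have "P + B + ennreal q = N + A + ennreal r"
    unfolding P_def B_def A_def N_def rq(3,4)[symmetric]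
    by (subst nn_integral_add[symmetric], measurable)+ (simp add: e2ennreal_add_balance)
  \<comment> \<open>The balance says nothing when both sides are infinite; the three bounds settle those cases.\<close>
  moreover have "P \<le> A + ennreal r"
    unfolding P_def A_def rq(3)[symmetric]
    by (subst nn_integral_add[symmetric]) (auto intro!: nn_integral_mono e2ennreal_add_le)
  moreover have "N \<le> B + ennreal q"
  proof -
    have "- (f t + ereal (g t)) = - f t + ereal (- g t)" for t
      by (cases "f t") auto
    then show ?thesis
      unfolding N_def B_def rq(4)[symmetric]
      by (subst nn_integral_add[symmetric]) (auto intro!: nn_integral_mono simp: e2ennreal_add_le)
  qed
  moreover have "A \<le> P + ennreal q"
  proof -
    have "(f t + ereal (g t)) + ereal (- g t) = f t" for t
      by (cases "f t") auto
    then have "e2ennreal (f t) \<le> e2ennreal (f t + ereal (g t)) + ennreal (- g t)" for t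
      using e2ennreal_add_le[of "f t + ereal (g t)" "- g t"] by simp
    then show ?thesis
      unfolding P_def A_def rq(4)[symmetric]
      by (subst nn_integral_add[symmetric]) (auto intro!: nn_integral_mono)
  qed
  ultimately have "enn2ereal P - enn2ereal N = enn2ereal A - enn2ereal B + ereal (r - q)"
    using rq(1,2)
    by (cases P; cases N; cases A; cases B) (auto simp: top_unique simp flip: ennreal_plus)
  then show ?thesis
    unfolding ext_integral_eq_nn_integral_diff P_def N_def A_def B_def rq(5) .
qed

text \<open>
  Monotone convergence from above. The positive parts decrease and have a finite initial integral,
  the negative parts increase. The limit of the integrals of the positive parts is finite, so the
  difference of the two limits involves no \<open>\<infinity> - \<infinity>\<close>.
\<close>
lemma ext_integral_decreasing_limit:
  assumes f[measurable]: "\<And>n. f n \<in> borel_measurable M"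
    and dec: "\<And>n. AE t in M. f (Suc n) t \<le> f n t"
    and lim: "AE t in M. (\<lambda>n. f n t) \<longlonglongrightarrow> F t"
    and fin: "ext_integral M (f 0) < \<infinity>"
  shows "(\<lambda>n. ext_integral M (f n)) \<longlonglongrightarrow> ext_integral M F"
proof -
  have AEdec: "AE t in M. decseq (\<lambda>n. f n t)"
    using dec unfolding decseq_Suc_iff by (simp add: AE_all_countable)
  have pos_dec: "AE t in M. e2ennreal (f (Suc n) t) \<le> e2ennreal (f n t)"
    and neg_inc: "AE t in M. e2ennreal (- f n t) \<le> e2ennreal (- f (Suc n) t)" for n
    using dec[of n] by (auto elim!: eventually_mono intro: e2ennreal_mono)
  have P0: "(\<integral>\<^sup>+ t. e2ennreal (f 0 t) \<partial>M) < \<infinity>"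
    using fin unfolding ext_integral_eq_nn_integral_diff
    by (cases "\<integral>\<^sup>+ t. e2ennreal (f 0 t) \<partial>M") auto
  have "(\<lambda>n. \<integral>\<^sup>+ t. e2ennreal (f n t) \<partial>M) \<longlonglongrightarrow> (INF n. \<integral>\<^sup>+ t. e2ennreal (f n t) \<partial>M)"
    using pos_dec by (intro LIMSEQ_INF decseq_SucI nn_integral_mono_AE)
  also have "(INF n. \<integral>\<^sup>+ t. e2ennreal (f n t) \<partial>M) = (\<integral>\<^sup>+ t. (INF n. e2ennreal (f n t)) \<partial>M)"
    using pos_dec P0 by (intro nn_integral_monotone_convergence_INF_AE'[symmetric]) auto
  also have "\<dots> = (\<integral>\<^sup>+ t. e2ennreal (F t) \<partial>M)"
  proof (intro nn_integral_cong_AE, use AEdec lim in eventually_elim)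
    case (elim t)
    have "(\<lambda>n. e2ennreal (f n t)) \<longlonglongrightarrow> (INF n. e2ennreal (f n t))"
      using elim(1) by (intro LIMSEQ_INF) (auto simp: decseq_def intro: e2ennreal_mono)
    moreover have "(\<lambda>n. e2ennreal (f n t)) \<longlonglongrightarrow> e2ennreal (F t)"
      using elim(2) by (rule tendsto_e2ennrealI)
    ultimately show ?case by (rule LIMSEQ_unique)
  qed
  finally have pos: "(\<lambda>n. \<integral>\<^sup>+ t. e2ennreal (f n t) \<partial>M) \<longlonglongrightarrow> (\<integral>\<^sup>+ t. e2ennreal (F t) \<partial>M)" .
  have "(\<lambda>n. \<integral>\<^sup>+ t. e2ennreal (- f n t) \<partial>M) \<longlonglongrightarrow> (SUP n. \<integral>\<^sup>+ t. e2ennreal (- f n t) \<partial>M)"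
    using neg_inc by (intro LIMSEQ_SUP incseq_SucI nn_integral_mono_AE)
  also have "(SUP n. \<integral>\<^sup>+ t. e2ennreal (- f n t) \<partial>M) = (\<integral>\<^sup>+ t. (SUP n. e2ennreal (- f n t)) \<partial>M)"
    using neg_inc by (intro nn_integral_monotone_convergence_SUP_AE[symmetric]) auto
  also have "\<dots> = (\<integral>\<^sup>+ t. e2ennreal (- F t) \<partial>M)"
  proof (intro nn_integral_cong_AE, use AEdec lim in eventually_elim)
    case (elim t)
    have "(\<lambda>n. e2ennreal (- f n t)) \<longlonglongrightarrow> (SUP n. e2ennreal (- f n t))"
      using elim(1) by (intro LIMSEQ_SUP) (auto simp: decseq_def incseq_def intro: e2ennreal_mono)
    moreover have "(\<lambda>n. e2ennreal (- f n t)) \<longlonglongrightarrow> e2ennreal (- F t)"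
      using elim(2) by (intro tendsto_e2ennrealI tendsto_uminus_ereal)
    ultimately show ?case by (rule LIMSEQ_unique)
  qed
  finally have neg: "(\<lambda>n. \<integral>\<^sup>+ t. e2ennreal (- f n t) \<partial>M) \<longlonglongrightarrow> (\<integral>\<^sup>+ t. e2ennreal (- F t) \<partial>M)" .
  have "(\<integral>\<^sup>+ t. e2ennreal (F t) \<partial>M) \<le> (\<integral>\<^sup>+ t. e2ennreal (f 0 t) \<partial>M)"
    using AEdec lim
    by (intro nn_integral_mono_AE, eventually_elim) (auto intro!: e2ennreal_mono decseq_ge)
  then have "(\<integral>\<^sup>+ t. e2ennreal (F t) \<partial>M) < \<infinity>" using P0 by (rule le_less_trans)
  then have "enn2ereal (\<integral>\<^sup>+ t. e2ennreal (F t) \<partial>M) \<noteq> \<infinity>" "enn2ereal (\<integral>\<^sup>+ t. e2ennreal (F t) \<partial>M) \<noteq> -\<infinity>"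
    by (cases "\<integral>\<^sup>+ t. e2ennreal (F t) \<partial>M"; simp)+
  then show ?thesis
    unfolding ext_integral_eq_nn_integral_diff using pos neg
    by (intro tendsto_diff_ereal_general tendsto_enn2erealI) auto
qed

section \<open>The directional derivative of the integral functional\<close>

lemma ext_infty_ereal [simp]: "ext_infty \<phi> (ereal u) = \<phi> u"
  by (simp add: ext_infty_def)

lemma ext_infty_measurable:
  assumes "proper_ereal \<phi>" "convex_ereal \<phi>" and [measurable]: "x \<in> borel_measurable M"
  shows "(\<lambda>t. ext_infty \<phi> (x t)) \<in> borel_measurable M"
proof -
  note [measurable] = convex_ereal_borel_measurable[OF assms(1,2)]
  show ?thesis unfolding ext_infty_def by measurable
qed

lemma AE_edom_if_int_functional_finite:
  assumes \<phi>: "proper_ereal \<phi>" "convex_ereal \<phi>" and x: "x \<in> borel_measurable M"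
    and fin: "int_functional M \<phi> x < \<infinity>"
  shows "AE t in M. x t = ereal (real_of_ereal (x t)) \<and> real_of_ereal (x t) \<in> edom \<phi>"
proof -
  note [measurable] = ext_infty_measurable[OF \<phi> x]
  have "(\<integral>\<^sup>+ t. e2ennreal (ext_infty \<phi> (x t)) \<partial>M) \<noteq> \<infinity>"
    using fin unfolding int_functional_def ext_integral_eq_nn_integral_diff by auto
  then have "AE t in M. e2ennreal (ext_infty \<phi> (x t)) \<noteq> \<infinity>"
    by (intro nn_integral_PInf_AE) simp
  then show ?thesis
  proof eventually_elim
    case (elim t)
    then show ?case
      by (cases "x t"; cases "\<phi> (real_of_ereal (x t))") (auto simp: ext_infty_def edom_def)
  qed
qed

text \<open>
  By additivity and homogeneity of the integral, the difference quotient of the functional is the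
  integral of the pointwise difference quotients, which decrease with the step. The third
  conclusion makes the limit integrand measurable up to a null set, as needed to pull constants out
  of its integral; it holds because that integrand is the limit of a sequence of measurable
  quotients.
\<close>
lemma directional_derivative_integral:
  assumes \<phi>: "proper_ereal \<phi>" "convex_ereal \<phi>"
    and diff: "(\<lambda>u. real_of_ereal (\<phi> u)) differentiable_on interior (edom \<phi>)"
    and xb[measurable]: "xb \<in> borel_measurable M" and x[measurable]: "x \<in> borel_measurable M"
    and fin_xb: "\<bar>int_functional M \<phi> xb\<bar> \<noteq> \<infinity>" and fin_x: "int_functional M \<phi> x < \<infinity>"
  defines "D \<equiv> ext_integral M (\<lambda>t. ext_deriv \<phi> (real_of_ereal (xb t)) * (x t - xb t))"
  shows "((\<lambda>s. (int_functional M \<phi> (\<lambda>t. xb t + ereal s * (x t - xb t)) - int_functional M \<phi> xb) / ereal s)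
           \<longlongrightarrow> D) (at_right 0)"
    and "D \<le> int_functional M \<phi> x - int_functional M \<phi> xb"
    and "\<exists>w\<in>borel_measurable M. AE t in M. ext_deriv \<phi> (real_of_ereal (xb t)) * (x t - xb t) = w t"
proof -
  note [measurable] = convex_ereal_borel_measurable[OF \<phi>]
  define p where "p = (\<lambda>t. real_of_ereal (xb t))"
  define h where "h = (\<lambda>t. real_of_ereal (x t) - real_of_ereal (xb t))"
  define g where "g = (\<lambda>t. real_of_ereal (ext_infty \<phi> (xb t)))"
  define Q where "Q = (\<lambda>s t. diff_quot \<phi> (p t) (h t) s)"
  define G where "G = integral\<^sup>L M g"
  define Dt where "Dt = (\<lambda>t. ext_deriv \<phi> (p t) * ereal (h t))"
  have [measurable]: "p \<in> borel_measurable M" "h \<in> borel_measurable M"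
    unfolding p_def h_def by measurable
  have Q_meas[measurable]: "Q s \<in> borel_measurable M" for s
    unfolding Q_def diff_quot_def by measurable
  have g: "integrable M g"
    using integrable_if_ext_integral_finite(2)[OF ext_infty_measurable[OF \<phi> xb]] fin_xb
    unfolding g_def int_functional_def by blast
  have fin_xb': "int_functional M \<phi> xb < \<infinity>" using fin_xb by auto
  \<comment> \<open>Off a null set all values are real and the segment runs inside the domain.\<close>
  have good: "AE t in M. xb t = ereal (p t) \<and> x t = ereal (p t + h t) \<and>
      p t \<in> edom \<phi> \<and> p t + h t \<in> edom \<phi> \<and> \<phi> (p t) = ereal (g t)"
    using AE_edom_if_int_functional_finite[OF \<phi> xb fin_xb'] AE_edom_if_int_functional_finite[OF \<phi> x fin_x]
  proof eventually_elim
    case (elim t)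
    then show ?case
      using finite_on_edom[OF \<phi>(1)] by (auto simp: p_def h_def g_def ext_infty_def)
  qed
  have val_xb: "int_functional M \<phi> xb = ereal G"
    unfolding int_functional_def G_def
    by (rule ext_integral_AE_eq_integrable[OF _ g], use good in eventually_elim) auto
  have val: "int_functional M \<phi> (\<lambda>t. xb t + ereal s * (x t - xb t)) = ereal s * ext_integral M (Q s) + ereal G"
    if s: "0 < s" "s \<le> 1" for s
  proof -
    have "int_functional M \<phi> (\<lambda>t. xb t + ereal s * (x t - xb t))
        = ext_integral M (\<lambda>t. ereal s * Q s t + ereal (g t))"
      unfolding int_functional_def
    proof (rule ext_integral_cong_AE, use good in eventually_elim)
      case (elim t)
      then have "\<phi> (p t + s * h t) = ereal (real_of_ereal (\<phi> (p t + s * h t)))"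
        using s by (intro finite_on_edom[OF \<phi>(1)] segment_in_edom[OF \<phi>(2)]) auto
      then show ?case
        using elim s by (cases "\<phi> (p t + s * h t)") (auto simp: Q_def diff_quot_def)
    qed
    also have "\<dots> = ereal s * ext_integral M (Q s) + ereal G"
      unfolding G_def using s g by (simp add: ext_integral_add_integrable ext_integral_cmult)
    finally show ?thesis .
  qed
  have quot: "(int_functional M \<phi> (\<lambda>t. xb t + ereal s * (x t - xb t)) - int_functional M \<phi> xb) / ereal s
      = ext_integral M (Q s)" if "0 < s" "s \<le> 1" for s
    using that by (cases "ext_integral M (Q s)") (simp_all add: val val_xb)
  have Q_mono: "AE t in M. Q s t \<le> Q r t" if "0 < s" "s \<le> r" "r \<le> 1" for s r
    using good by eventually_elim (auto simp: Q_def intro!: diff_quot_mono[OF \<phi>] that)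
  have D_eq: "D = ext_integral M Dt"
    unfolding D_def
  proof (rule ext_integral_cong_AE, use good in eventually_elim)
    case (elim t)
    then have "x t - xb t = ereal (h t)" by simp
    then show ?case by (simp add: Dt_def p_def)
  qed
  have "int_functional M \<phi> x = int_functional M \<phi> (\<lambda>t. xb t + ereal 1 * (x t - xb t))"
    unfolding int_functional_def by (rule ext_integral_cong_AE, use good in eventually_elim) auto
  then have val_x: "int_functional M \<phi> x = ext_integral M (Q 1) + ereal G"
    using val[of 1] by (simp flip: one_ereal_def)
  have "Dt t \<le> Q 1 t" if "p t \<in> edom \<phi>" "p t + h t \<in> edom \<phi>" for t
    using diff_quot_ge_ext_deriv[OF \<phi> diff that] unfolding Dt_def Q_def diff_quot_def
    by (simp add: divide_ereal_def flip: one_ereal_def)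
  then have "D \<le> ext_integral M (Q 1)"
    unfolding D_eq by (intro ext_integral_mono_AE, use good in eventually_elim) blast
  then show "D \<le> int_functional M \<phi> x - int_functional M \<phi> xb"
    unfolding val_x val_xb by (cases "ext_integral M (Q 1)") auto
  have Q1: "ext_integral M (Q 1) < \<infinity>"
    using fin_x unfolding val_x by auto
  have Q_lim: "AE t in M. (\<lambda>n. Q (S n) t) \<longlonglongrightarrow> Dt t" if "filterlim S (at_right 0) sequentially" for S
    using good
  proof eventually_elim
    case (elim t)
    then show ?case
      unfolding Q_def Dt_def
      by (intro filterlim_compose[OF diff_quot_tendsto_ext_deriv[OF \<phi> diff] that]) auto
  qed
  have "((\<lambda>s. ext_integral M (Q s)) \<longlongrightarrow> D) (at_right 0)"
  proof (rule tendsto_at_right_sequentially[of 0 1])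
    fix S :: "nat \<Rightarrow> real"
    assume S: "\<And>n. 0 < S n" "\<And>n. S n < 1" "decseq S" "S \<longlonglongrightarrow> 0"
    \<comment> \<open>A right limit may be tested on decreasing sequences, where monotone convergence applies.\<close>
    have S_right: "filterlim S (at_right 0) sequentially"
      using S by (intro tendsto_imp_filterlim_at_right) auto
    show "(\<lambda>n. ext_integral M (Q (S n))) \<longlonglongrightarrow> D"
      unfolding D_eq
    proof (rule ext_integral_decreasing_limit)
      show "AE t in M. Q (S (Suc n)) t \<le> Q (S n) t" for n
        using S by (intro Q_mono) (auto simp: decseq_Suc_iff less_imp_le)
      show "AE t in M. (\<lambda>n. Q (S n) t) \<longlonglongrightarrow> Dt t"
        using S_right by (rule Q_lim)
      have "ext_integral M (Q (S 0)) \<le> ext_integral M (Q 1)"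
        using S by (intro ext_integral_mono_AE Q_mono) (auto simp: less_imp_le)
      then show "ext_integral M (Q (S 0)) < \<infinity>" using Q1 by (rule le_less_trans)
    qed simp
  qed simp
  then show "((\<lambda>s. (int_functional M \<phi> (\<lambda>t. xb t + ereal s * (x t - xb t)) - int_functional M \<phi> xb) / ereal s)
           \<longlongrightarrow> D) (at_right 0)"
    by (rule Lim_transform_eventually) (use eventually_in_at_right_1 quot in \<open>auto elim!: eventually_mono\<close>)
  have "filterlim (\<lambda>n. inverse (real (Suc n))) (at_right 0) sequentially"
    using LIMSEQ_inverse_real_of_nat by (intro tendsto_imp_filterlim_at_right) auto
  from Q_lim[OF this] have "AE t in M. Dt t = liminf (\<lambda>n. Q (inverse (real (Suc n))) t)"
    by eventually_elim (metis lim_imp_Liminf sequentially_bot)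
  with good have "AE t in M. ext_deriv \<phi> (real_of_ereal (xb t)) * (x t - xb t)
      = liminf (\<lambda>n. Q (inverse (real (Suc n))) t)"
  proof eventually_elim
    case (elim t)
    then have "x t - xb t = ereal (h t)" by simp
    then show ?case using elim(2) by (simp add: Dt_def p_def)
  qed
  moreover have "(\<lambda>t. liminf (\<lambda>n. Q (inverse (real (Suc n))) t)) \<in> borel_measurable M"
    by measurable
  ultimately show "\<exists>w\<in>borel_measurable M. AE t in M. ext_deriv \<phi> (real_of_ereal (xb t)) * (x t - xb t) = w t"
    by (rule bexI)
qed

section \<open>Moment constraints\<close>

lemma M0_space_AE:
  "x \<in> M0_space M \<Longrightarrow> AE t in M. x t = ereal (real_of_ereal (x t))"
  by (auto simp: M0_space_def ereal_real elim!: eventually_mono)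

lemma M0_space_AE_cong:
  assumes "x \<in> M0_space M" "y \<in> M0_space M" "z \<in> borel_measurable M" "AE t in M. z t = x t + ereal c * y t"
  shows "z \<in> M0_space M"
proof -
  have "AE t in M. \<bar>z t\<bar> \<noteq> \<infinity>"
    using M0_space_AE[OF assms(1)] M0_space_AE[OF assms(2)] assms(4)
  proof eventually_elim
    case (elim t)
    then show ?case by (cases "x t"; cases "y t") auto
  qed
  then show ?thesis using assms(3) by (simp add: M0_space_def)
qed

text \<open>
  Passing to an honest integrable real function replaces the extended integral by the linear
  Lebesgue integral.
\<close>
lemma X_spE:
  assumes "x \<in> X_sp M \<psi> k"
  obtains g where "integrable M g" "AE t in M. x t * \<psi> k t = ereal (g t)" "Psi M \<psi> k x = integral\<^sup>L M g"
proof -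
  have meas: "(\<lambda>t. x t * \<psi> k t) \<in> borel_measurable M" and fin: "\<bar>ext_integral M (\<lambda>t. x t * \<psi> k t)\<bar> \<noteq> \<infinity>"
    using assms by (auto simp: X_sp_def L1_space_def)
  note g = integrable_if_ext_integral_finite[OF meas fin]
  show thesis
    using that[OF g(2) g(1)] ext_integral_AE_eq_integrable[OF g] by (simp add: Psi_def)
qed

text \<open>
  The moment functionals are linear. The sum is prescribed only almost everywhere because
  \<^typ>\<open>ereal\<close> arithmetic is not linear at the points where the functions are infinite.
\<close>
lemma X_sp_combine:
  assumes \<psi>: "\<psi> k \<in> M0_space M" and x: "x \<in> X_sp M \<psi> k" and y: "y \<in> X_sp M \<psi> k"
    and z: "z \<in> borel_measurable M" "AE t in M. z t = x t + ereal c * y t"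
  shows "z \<in> X_sp M \<psi> k" and "Psi M \<psi> k z = Psi M \<psi> k x + c * Psi M \<psi> k y"
proof -
  have M0: "x \<in> M0_space M" "y \<in> M0_space M" using x y by (auto simp: X_sp_def)
  have [measurable]: "\<psi> k \<in> borel_measurable M" "z \<in> borel_measurable M"
    using \<psi> z by (auto simp: M0_space_def)
  obtain g where g: "integrable M g" "AE t in M. x t * \<psi> k t = ereal (g t)" "Psi M \<psi> k x = integral\<^sup>L M g"
    using x by (rule X_spE)
  obtain h where h: "integrable M h" "AE t in M. y t * \<psi> k t = ereal (h t)" "Psi M \<psi> k y = integral\<^sup>L M h"
    using y by (rule X_spE)
  have int: "integrable M (\<lambda>t. g t + c * h t)" using g h by simp
  have "AE t in M. z t * \<psi> k t = ereal (g t + c * h t)"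
    using z(2) g(2) h(2) M0_space_AE[OF M0(1)] M0_space_AE[OF M0(2)] M0_space_AE[OF \<psi>]
  proof eventually_elim
    case (elim t)
    then show ?case by (cases "x t"; cases "y t"; cases "\<psi> k t") (auto simp: algebra_simps)
  qed
  then have eq: "ext_integral M (\<lambda>t. z t * \<psi> k t) = ereal (integral\<^sup>L M (\<lambda>t. g t + c * h t))"
    using int by (rule ext_integral_AE_eq_integrable)
  then show "z \<in> X_sp M \<psi> k"
    using M0_space_AE_cong[OF M0 z] by (simp add: X_sp_def L1_space_def)
  show "Psi M \<psi> k z = Psi M \<psi> k x + c * Psi M \<psi> k y"
    using eq g h by (simp add: Psi_def)
qed

lemma F_set_diff_in_X0_tilde:
  assumes \<psi>: "\<And>k. k \<in> {1..m} \<Longrightarrow> \<psi> k \<in> M0_space M"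
    and x: "x \<in> F_set M \<psi> m b" and y: "y \<in> F_set M \<psi> m b"
    and z: "z \<in> borel_measurable M" "AE t in M. z t = x t - y t"
  shows "z \<in> X0_tilde M \<psi> m"
proof -
  have "z \<in> X_sp M \<psi> k \<and> Psi M \<psi> k z = 0" if k: "k \<in> {1..m}" for k
  proof -
    have xy: "x \<in> X_sp M \<psi> k" "y \<in> X_sp M \<psi> k" "Psi M \<psi> k x = b k" "Psi M \<psi> k y = b k"
      using x y k by (auto simp: F_set_def X_tilde_def)
    have "AE t in M. z t = x t + ereal (-1) * y t"
    proof (use z(2) in eventually_elim)
      case (elim t)
      then show ?case by (cases "y t") (auto simp: minus_ereal_def)
    qed
    from X_sp_combine[OF \<psi>[OF k] xy(1,2) z(1) this] xy show ?thesis by simp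
  qed
  then show ?thesis by (simp add: X0_tilde_def X0_sp_def)
qed

lemma F_set_add_X0_tilde:
  assumes \<psi>: "\<And>k. k \<in> {1..m} \<Longrightarrow> \<psi> k \<in> M0_space M"
    and x: "x \<in> F_set M \<psi> m b" and u: "u \<in> X0_tilde M \<psi> m"
    and z: "z \<in> borel_measurable M" "AE t in M. z t = x t + ereal c * u t"
  shows "z \<in> F_set M \<psi> m b"
proof -
  have "z \<in> X_sp M \<psi> k \<and> Psi M \<psi> k z = b k" if k: "k \<in> {1..m}" for k
  proof -
    have xu: "x \<in> X_sp M \<psi> k" "u \<in> X_sp M \<psi> k" "Psi M \<psi> k x = b k" "Psi M \<psi> k u = 0"
      using x u k by (auto simp: F_set_def X_tilde_def X0_tilde_def X0_sp_def)
    from X_sp_combine[OF \<psi>[OF k] xu(1,2) z] xu show ?thesis by simp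
  qed
  then show ?thesis by (simp add: F_set_def X_tilde_def)
qed

text \<open>
  Almost everywhere all factors are finite, so the product expands into real multiples of the
  \<open>u t * \<psi> k t\<close>, each with integral zero.
\<close>
lemma ext_integral_combination_eq_0:
  assumes \<psi>: "\<And>k. k \<in> {1..m} \<Longrightarrow> \<psi> k \<in> M0_space M"
    and u: "u \<in> X0_tilde M \<psi> m" "AE t in M. \<bar>u t\<bar> \<noteq> \<infinity>"
    and w: "AE t in M. w t = (\<Sum>k\<in>{1..m}. ereal (\<alpha> k) * \<psi> k t)"
  shows "ext_integral M (\<lambda>t. w t * u t) = 0"
proof -
  have "\<forall>k\<in>{1..m}. \<exists>g. integrable M g \<and> (AE t in M. u t * \<psi> k t = ereal (g t)) \<and> integral\<^sup>L M g = 0"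
  proof
    fix k assume "k \<in> {1..m}"
    then have "u \<in> X_sp M \<psi> k" "Psi M \<psi> k u = 0"
      using u by (auto simp: X0_tilde_def X0_sp_def)
    then show "\<exists>g. integrable M g \<and> (AE t in M. u t * \<psi> k t = ereal (g t)) \<and> integral\<^sup>L M g = 0"
      by (metis X_spE)
  qed
  then obtain g where g: "\<And>k. k \<in> {1..m} \<Longrightarrow> integrable M (g k)"
    "\<And>k. k \<in> {1..m} \<Longrightarrow> AE t in M. u t * \<psi> k t = ereal (g k t)"
    "\<And>k. k \<in> {1..m} \<Longrightarrow> integral\<^sup>L M (g k) = 0"
    by metis
  have "AE t in M. \<forall>k\<in>{1..m}. u t * \<psi> k t = ereal (g k t) \<and> \<psi> k t = ereal (real_of_ereal (\<psi> k t))"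
    using g(2) \<psi> by (intro AE_finite_allI) (auto intro: M0_space_AE)
  then have "AE t in M. w t * u t = ereal (\<Sum>k\<in>{1..m}. \<alpha> k * g k t)"
    using w u(2)
  proof eventually_elim
    case (elim t)
    obtain r where r: "u t = ereal r" using elim(3) by (cases "u t") auto
    define q where "q k = real_of_ereal (\<psi> k t)" for k
    have q: "\<psi> k t = ereal (q k)" "g k t = r * q k" if "k \<in> {1..m}" for k
    proof -
      show "\<psi> k t = ereal (q k)" using elim(1) that by (simp add: q_def)
      then show "g k t = r * q k" using elim(1) that r by force
    qed
    have "w t = ereal (\<Sum>k\<in>{1..m}. \<alpha> k * q k)"
      unfolding elim(2) sum_ereal[symmetric] by (intro sum.cong) (auto simp: q)
    then show ?case by (simp add: r q sum_distrib_left mult.commute mult.left_commute)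
  qed
  then have "ext_integral M (\<lambda>t. w t * u t) = ereal (\<integral>t. (\<Sum>k\<in>{1..m}. \<alpha> k * g k t) \<partial>M)"
    using g(1) by (intro ext_integral_AE_eq_integrable) auto
  also have "\<dots> = 0" using g(1,3) by (simp add: integral_sum zero_ereal_def)
  finally show ?thesis .
qed

section \<open>Optimality conditions\<close>

theorem proposition5:
  fixes M :: "'a measure"
    and \<phi> :: "real \<Rightarrow> ereal"
    and X :: "('a \<Rightarrow> ereal) set"
    and m :: nat
    and \<psi> :: "nat \<Rightarrow> 'a \<Rightarrow> ereal"
    and b :: "nat \<Rightarrow> real"
    and xb :: "'a \<Rightarrow> ereal"
  assumes "proper_ereal \<phi>"
    and "convex_ereal \<phi>"
    and "lsc_ereal \<phi>"
    and "strictly_convex_ereal_on (edom \<phi>) \<phi>"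
    and "interior (edom \<phi>) \<noteq> {}"
    and "(\<lambda>u. real_of_ereal (\<phi> u)) differentiable_on interior (edom \<phi>)"
    and "linear_space_ae M X"
    and "m \<ge> 1"
    and "\<And>k. k \<in> {1..m} \<Longrightarrow> \<psi> k \<in> M0_space M"
    and "xb \<in> X \<inter> F_set M \<psi> m b"
    and "\<bar>int_functional M \<phi> xb\<bar> \<noteq> \<infinity>"
  shows "(is_solution M \<phi> X \<psi> m b xb \<longleftrightarrow>
           (\<forall>x \<in> F_set M \<psi> m b \<inter> dom_functional M \<phi> X.
              dir_deriv M \<phi> xb (\<lambda>t. x t - xb t) \<ge> 0))
       \<and> ((\<forall>x \<in> F_set M \<psi> m b \<inter> dom_functional M \<phi> X.
              dir_deriv M \<phi> xb (\<lambda>t. x t - xb t) \<ge> 0) \<longleftrightarrow>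
           (\<forall>u \<in> K_cone M \<phi> X \<psi> m xb.
              ext_integral M (\<lambda>t. ext_deriv \<phi> (real_of_ereal (xb t)) * u t) \<ge> 0))
       \<and> ((\<exists>\<alpha>::nat \<Rightarrow> real. AE t in M.
              ext_deriv \<phi> (real_of_ereal (xb t)) = (\<Sum>k\<in>{1..m}. ereal (\<alpha> k) * \<psi> k t))
           \<longrightarrow> is_solution M \<phi> X \<psi> m b xb)"
proof -
  note \<phi> = assms(1,2) and diff = assms(6) and \<psi> = assms(9) and fin_xb = assms(11)
  have xb: "xb \<in> X" "xb \<in> F_set M \<psi> m b" using assms(10) by auto
  have X_M0: "x \<in> M0_space M"
    and X_scale: "(\<lambda>t. ereal c * x t) \<in> X" if "x \<in> X" for x and c :: real
    using assms(7) that by (simp_all add: linear_space_ae_def subset_iff)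
  have X_add: "(\<lambda>t. x t + y t) \<in> X" if "x \<in> X" "y \<in> X" for x y
    using assms(7) that by (simp add: linear_space_ae_def)
  have X_meas: "x \<in> borel_measurable M" if "x \<in> X" for x
    using X_M0[OF that] by (simp add: M0_space_def)
  have dom: "x \<in> X" "int_functional M \<phi> x < \<infinity>" if "x \<in> dom_functional M \<phi> X" for x
    using that by (auto simp: dom_functional_def)
  define I where "I u = ext_integral M (\<lambda>t. ext_deriv \<phi> (real_of_ereal (xb t)) * u t)" for u
  \<comment> \<open>The segment from the candidate to a competitor.\<close>
  define ray where "ray x s = (\<lambda>t. xb t + ereal s * (x t - xb t))" for x s
  have limit: "((\<lambda>s. (int_functional M \<phi> (ray x s) - int_functional M \<phi> xb) / ereal s)
        \<longlongrightarrow> I (\<lambda>t. x t - xb t)) (at_right 0)"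
    and increment: "I (\<lambda>t. x t - xb t) \<le> int_functional M \<phi> x - int_functional M \<phi> xb"
    and deriv_measurable: "\<exists>w\<in>borel_measurable M. AE t in M.
        ext_deriv \<phi> (real_of_ereal (xb t)) * (x t - xb t) = w t"
    if "x \<in> dom_functional M \<phi> X" for x
  proof -
    note D = directional_derivative_integral[OF \<phi> diff X_meas[OF xb(1)] X_meas[OF dom(1)[OF that]] fin_xb dom(2)[OF that]]
    show "((\<lambda>s. (int_functional M \<phi> (ray x s) - int_functional M \<phi> xb) / ereal s)
        \<longlongrightarrow> I (\<lambda>t. x t - xb t)) (at_right 0)"
      unfolding I_def ray_def by (rule D(1))
    show "I (\<lambda>t. x t - xb t) \<le> int_functional M \<phi> x - int_functional M \<phi> xb"
      unfolding I_def by (rule D(2))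
    show "\<exists>w\<in>borel_measurable M. AE t in M.
        ext_deriv \<phi> (real_of_ereal (xb t)) * (x t - xb t) = w t"
      by (rule D(3))
  qed
  have dir_deriv_eq: "dir_deriv M \<phi> xb (\<lambda>t. x t - xb t) = I (\<lambda>t. x t - xb t)"
    if "x \<in> dom_functional M \<phi> X" for x
    unfolding dir_deriv_def using limit[OF that] unfolding ray_def
    by (intro tendsto_Lim) auto
  have X_minus: "(\<lambda>t. x t - xb t) \<in> X" if "x \<in> X" for x
  proof -
    have "(\<lambda>t. x t + ereal (-1) * xb t) \<in> X"
      by (rule X_add[OF that X_scale[OF xb(1)]])
    moreover have "x t + ereal (-1) * xb t = x t - xb t" for t
      by (cases "xb t") (auto simp: minus_ereal_def)
    ultimately show ?thesis by simp
  qed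
  have diff_X0: "(\<lambda>t. x t - xb t) \<in> X0_tilde M \<psi> m" if "x \<in> X" "x \<in> F_set M \<psi> m b" for x
    using F_set_diff_in_X0_tilde[OF \<psi> that(2) xb(2) X_meas[OF X_minus[OF that(1)]]] by simp
  have ray_feasible: "ray x s \<in> X \<inter> F_set M \<psi> m b" if "x \<in> X" "x \<in> F_set M \<psi> m b" for x s
  proof -
    have "ray x s \<in> X"
      unfolding ray_def by (rule X_add[OF xb(1) X_scale[OF X_minus[OF that(1)]]])
    then show ?thesis
      using F_set_add_X0_tilde[OF \<psi> xb(2) diff_X0[OF that] X_meas] by (auto simp: ray_def)
  qed

  have i_imp_ii: "0 \<le> I (\<lambda>t. x t - xb t)"
    if sol: "is_solution M \<phi> X \<psi> m b xb" and x: "x \<in> F_set M \<psi> m b \<inter> dom_functional M \<phi> X" for x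
  proof (rule tendsto_lowerbound)
    show "((\<lambda>s. (int_functional M \<phi> (ray x s) - int_functional M \<phi> xb) / ereal s)
        \<longlongrightarrow> I (\<lambda>t. x t - xb t)) (at_right 0)"
      using limit x by blast
    have "0 \<le> (int_functional M \<phi> (ray x s) - int_functional M \<phi> xb) / ereal s" if "0 < s" for s
    proof -
      have "int_functional M \<phi> xb \<le> int_functional M \<phi> (ray x s)"
        using sol ray_feasible x dom(1) unfolding is_solution_def by blast
      then have "0 \<le> int_functional M \<phi> (ray x s) - int_functional M \<phi> xb"
        using fin_xb by (intro ereal_diff_positive) auto
      then show ?thesis using that by (simp add: zero_le_divide_ereal)
    qed
    then show "\<forall>\<^sub>F s in at_right 0. 0 \<le> (int_functional M \<phi> (ray x s) - int_functional M \<phi> xb) / ereal s"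
      by (auto intro: eventually_mono[OF eventually_at_right_less])
  qed simp
  have ii_imp_i: "is_solution M \<phi> X \<psi> m b xb"
    if ii: "\<And>x. x \<in> F_set M \<psi> m b \<inter> dom_functional M \<phi> X \<Longrightarrow> 0 \<le> I (\<lambda>t. x t - xb t)"
    unfolding is_solution_def
  proof (intro conjI ballI)
    show "xb \<in> X \<inter> F_set M \<psi> m b" by (rule assms(10))
    fix x assume x: "x \<in> X \<inter> F_set M \<psi> m b"
    show "int_functional M \<phi> xb \<le> int_functional M \<phi> x"
    proof (cases "int_functional M \<phi> x < \<infinity>")
      case True
      then have "x \<in> dom_functional M \<phi> X" using x by (simp add: dom_functional_def)
      then have "0 \<le> int_functional M \<phi> x - int_functional M \<phi> xb"
        using ii[of x] increment[of x] x by (meson IntE IntI order_trans)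
      then show ?thesis
        using fin_xb by (cases "int_functional M \<phi> x"; cases "int_functional M \<phi> xb") auto
    qed auto
  qed
  have ii_imp_iii: "0 \<le> I u"
    if ii: "\<And>x. x \<in> F_set M \<psi> m b \<inter> dom_functional M \<phi> X \<Longrightarrow> 0 \<le> I (\<lambda>t. x t - xb t)"
      and u: "u \<in> K_cone M \<phi> X \<psi> m xb" for u
  proof -
    obtain l x where l: "l \<ge> 0" and x: "x \<in> dom_functional M \<phi> X"
      and ul: "AE t in M. u t = ereal l * (x t - xb t)"
      using u by (auto simp: K_cone_def cone_at_def)
    have u0: "u \<in> X0_tilde M \<psi> m" using u by (simp add: K_cone_def)
    show ?thesis
    \<comment> \<open>For a positive factor, the competitor that generates the direction is itself feasible.\<close>
    proof (cases "l = 0")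
      case True
      then have "I u = ext_integral M (\<lambda>t. 0)"
        unfolding I_def using ul by (intro ext_integral_cong_AE) (auto elim!: eventually_mono simp flip: zero_ereal_def)
      then show ?thesis by (simp add: ext_integral_def)
    next
      case False
      then have "l > 0" using l by simp
      have fin: "AE t in M. x t = ereal (real_of_ereal (x t))" "AE t in M. xb t = ereal (real_of_ereal (xb t))"
        using X_M0 x dom(1) xb(1) by (auto intro: M0_space_AE)
      have "AE t in M. x t = xb t + ereal (1 / l) * u t"
        using ul fin
      proof eventually_elim
        case (elim t)
        then show ?case using \<open>l > 0\<close> by (cases "x t"; cases "xb t") auto
      qed
      then have "x \<in> F_set M \<psi> m b"
        using F_set_add_X0_tilde[OF \<psi> xb(2) u0 X_meas[OF dom(1)[OF x]]] by blast
      then have nonneg: "0 \<le> I (\<lambda>t. x t - xb t)" using ii x by blast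
      obtain w where w: "w \<in> borel_measurable M"
        "AE t in M. ext_deriv \<phi> (real_of_ereal (xb t)) * (x t - xb t) = w t"
        using deriv_measurable[OF x] by blast
      have "I u = ext_integral M (\<lambda>t. ereal l * w t)"
        unfolding I_def
      proof (rule ext_integral_cong_AE, use ul w(2) in eventually_elim)
        case (elim t)
        show ?case unfolding elim(1) elim(2)[symmetric] by (simp only: mult.left_commute)
      qed
      also have "\<dots> = ereal l * ext_integral M w"
        using w(1) \<open>l > 0\<close> by (rule ext_integral_cmult)
      also have "ext_integral M w = I (\<lambda>t. x t - xb t)"
        unfolding I_def using w(2) by (intro ext_integral_cong_AE) (auto elim!: eventually_mono)
      finally show ?thesis using nonneg \<open>l > 0\<close> by simp
    qed
  qed
  have iii_imp_ii: "0 \<le> I (\<lambda>t. x t - xb t)"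
    if iii: "\<And>u. u \<in> K_cone M \<phi> X \<psi> m xb \<Longrightarrow> 0 \<le> I u"
      and x: "x \<in> F_set M \<psi> m b \<inter> dom_functional M \<phi> X" for x
  proof (rule iii)
    have xX: "x \<in> X" using x dom(1) by blast
    have "(\<lambda>t. x t - xb t) \<in> cone_at M (dom_functional M \<phi> X) xb"
      unfolding cone_at_def using x X_meas[OF X_minus[OF xX]]
      by (auto intro!: exI[of _ 1] bexI[of _ x] simp flip: one_ereal_def)
    then show "(\<lambda>t. x t - xb t) \<in> K_cone M \<phi> X \<psi> m xb"
      using diff_X0[OF xX] x by (simp add: K_cone_def)
  qed
  have multiplier: "0 \<le> I u"
    if \<alpha>: "AE t in M. ext_deriv \<phi> (real_of_ereal (xb t)) = (\<Sum>k\<in>{1..m}. ereal (\<alpha> k) * \<psi> k t)"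
      and u: "u \<in> X0_tilde M \<psi> m" for \<alpha> u
  proof -
    \<comment> \<open>At least one constraint is present, which makes the direction finite almost everywhere.\<close>
    have "u \<in> X_sp M \<psi> 1" using u assms(8) by (auto simp: X0_tilde_def X0_sp_def)
    then have "AE t in M. \<bar>u t\<bar> \<noteq> \<infinity>" by (simp add: X_sp_def M0_space_def)
    then show ?thesis
      unfolding I_def using ext_integral_combination_eq_0[OF \<psi> u _ \<alpha>] by simp
  qed
  have K_X0: "u \<in> X0_tilde M \<psi> m" if "u \<in> K_cone M \<phi> X \<psi> m xb" for u
    using that by (simp add: K_cone_def)
  have dir: "(\<forall>x \<in> F_set M \<psi> m b \<inter> dom_functional M \<phi> X. 0 \<le> dir_deriv M \<phi> xb (\<lambda>t. x t - xb t))
      \<longleftrightarrow> (\<forall>x \<in> F_set M \<psi> m b \<inter> dom_functional M \<phi> X. 0 \<le> I (\<lambda>t. x t - xb t))"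
    by (intro ball_cong refl) (simp add: dir_deriv_eq)
  have i_iff_ii: "is_solution M \<phi> X \<psi> m b xb \<longleftrightarrow>
      (\<forall>x \<in> F_set M \<psi> m b \<inter> dom_functional M \<phi> X. 0 \<le> I (\<lambda>t. x t - xb t))"
  proof
    show "\<forall>x \<in> F_set M \<psi> m b \<inter> dom_functional M \<phi> X. 0 \<le> I (\<lambda>t. x t - xb t)"
      if "is_solution M \<phi> X \<psi> m b xb"
      using i_imp_ii[OF that] by (rule ballI)
    show "is_solution M \<phi> X \<psi> m b xb"
      if "\<forall>x \<in> F_set M \<psi> m b \<inter> dom_functional M \<phi> X. 0 \<le> I (\<lambda>t. x t - xb t)"
      by (rule ii_imp_i[OF bspec[OF that]])
  qed
  have ii_iff_iii: "(\<forall>x \<in> F_set M \<psi> m b \<inter> dom_functional M \<phi> X. 0 \<le> I (\<lambda>t. x t - xb t))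
      \<longleftrightarrow> (\<forall>u \<in> K_cone M \<phi> X \<psi> m xb. 0 \<le> I u)"
  proof
    show "\<forall>u \<in> K_cone M \<phi> X \<psi> m xb. 0 \<le> I u"
      if "\<forall>x \<in> F_set M \<psi> m b \<inter> dom_functional M \<phi> X. 0 \<le> I (\<lambda>t. x t - xb t)"
      using ii_imp_iii[OF bspec[OF that]] by (rule ballI)
    show "\<forall>x \<in> F_set M \<psi> m b \<inter> dom_functional M \<phi> X. 0 \<le> I (\<lambda>t. x t - xb t)"
      if "\<forall>u \<in> K_cone M \<phi> X \<psi> m xb. 0 \<le> I u"
      using iii_imp_ii[OF bspec[OF that]] by (rule ballI)
  qed
  have part_b: "is_solution M \<phi> X \<psi> m b xb"
    if "\<exists>\<alpha>::nat \<Rightarrow> real. AE t in M.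
      ext_deriv \<phi> (real_of_ereal (xb t)) = (\<Sum>k\<in>{1..m}. ereal (\<alpha> k) * \<psi> k t)"
  proof -
    from that obtain \<alpha> :: "nat \<Rightarrow> real" where \<alpha>: "AE t in M.
      ext_deriv \<phi> (real_of_ereal (xb t)) = (\<Sum>k\<in>{1..m}. ereal (\<alpha> k) * \<psi> k t)" ..
    have "\<forall>u \<in> K_cone M \<phi> X \<psi> m xb. 0 \<le> I u"
      using multiplier[OF \<alpha> K_X0] by (rule ballI)
    then show ?thesis unfolding i_iff_ii ii_iff_iii .
  qed
  show ?thesis
    unfolding dir using i_iff_ii ii_iff_iii part_b unfolding I_def by (intro conjI impI)
qed

end
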